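(* For all $\xi\in(0,1)$ and all $\beta>0$ (with $\tau>0$ and $0<\alpha_2<\alpha_1$), the system $$\ddot w_1(t,x)-\frac{\partial^2w_1}{\partial x^2}(t,x)+\alpha_1\dot w_1(t,\xi)\delta_\xi+\alpha_2\dot w_1(t-\tau,\xi)\delta_\xi+\beta\frac{\partial\dot w_2}{\partial x}(t,x)=0,\quad (t,x)\in(0,\infty)\times(0,1),$$ $$\ddot w_2(t,x)-\frac{\partial^2w_2}{\partial x^2}(t,x)+\beta\frac{\partial\dot w_1}{\partial x}(t,x)=0,\quad (t,x)\in(0,\infty)\times(0,1),$$ $$w_i(t,0)=w_i(t,1)=0,\quad t\in(0,\infty),\ i=1,2,$$ $$w_i(0,x)=w_i^0(x),\quad \dot w_i(0,x)=w_i^1(x),\quad \dot w_1(s,x)=f_0(s,x),\ -\tau\le s<0,\ x\in(0,1),\ i=1,2,$$ is not exponentially stable in the energy space.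
   Context: Dots denote time derivatives and $\delta_\xi$ is the Dirac mass at $\xi$. The energy is $$E_d(t)=\frac12\sum_{i=1}^2\int_0^1\left(\left|\frac{\partial w_i}{\partial x}(t,x)\right|^2+|\dot w_i(t,x)|^2\right)dx+\frac{\kappa}{2}\int_{-\tau}^0|\dot w_1(t+\theta,\xi)|^2\,d\theta,$$ with $\kappa$ a fixed constant satisfying $\tau\alpha_2\le\kappa\le\tau(2\alpha_1-\alpha_2)$. Exponential stability in the energy space means that there exist constants $M,\omega>0$ such that $E_d(t)\le Me^{-\omega t}E_d(0)$ for all $t\ge0$ and all solutions with initial data satisfying $w_1^0\in H_0^1(0,1)$, $w_2^0\in H^2(0,1)\cap H_0^1(0,1)$, $w_1^1,w_2^1\in H_0^1(0,1)$, $f_0\in H^1(-\tau,0;H_0^1(0,1))$, $f_0(0,\xi)=w_1^1(\xi)$ and $-\frac{d^2w_1^0}{dx^2}+\big(\alpha_1w_1^1(\xi)+\alpha_2f_0(-\tau,\xi)\big)\delta_\xi\in L^2(0,1)$. *)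

theory Defs
  imports "HOL-Analysis.Analysis"
begin

section \<open>Distributions and Sobolev spaces on a bounded interval\<close>

definition L2 :: "real \<Rightarrow> real \<Rightarrow> (real \<Rightarrow> real) set" where
  "L2 a b = {f. f \<in> borel_measurable (lebesgue_on {a<..<b}) \<and>
                integrable (lebesgue_on {a<..<b}) (\<lambda>x. (f x)\<^sup>2)}"

definition L2_norm :: "real \<Rightarrow> real \<Rightarrow> (real \<Rightarrow> real) \<Rightarrow> real" where
  "L2_norm a b f = sqrt (LINT x|lebesgue_on {a<..<b}. (f x)\<^sup>2)"

definition test_fun :: "real \<Rightarrow> real \<Rightarrow> (real \<Rightarrow> real) set" where
  "test_fun a b = {\<phi>. (\<forall>k x. (deriv ^^ k) \<phi> field_differentiable at x) \<and>
                      (\<exists>c d. a < c \<and> c \<le> d \<and> d < b \<and> (\<forall>x. x \<notin> {c..d} \<longrightarrow> \<phi> x = 0))}"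

text \<open>A distribution on (a,b) is represented by the functional it induces on test functions;
  two distributions are compared on \<^const>\<open>test_fun\<close> only.\<close>

type_synonym distr = "(real \<Rightarrow> real) \<Rightarrow> real"

definition regular :: "real \<Rightarrow> real \<Rightarrow> (real \<Rightarrow> real) \<Rightarrow> distr" where
  "regular a b f \<phi> = (LINT x|lebesgue_on {a<..<b}. f x * \<phi> x)"

definition dirac :: "real \<Rightarrow> distr" where
  "dirac \<xi> \<phi> = \<phi> \<xi>"

definition distr_deriv :: "distr \<Rightarrow> distr" where
  "distr_deriv T \<phi> = - T (deriv \<phi>)"

definition weak_deriv :: "real \<Rightarrow> real \<Rightarrow> (real \<Rightarrow> real) \<Rightarrow> (real \<Rightarrow> real) \<Rightarrow> bool" where
  "weak_deriv a b f g \<longleftrightarrow>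
     (\<forall>\<phi>\<in>test_fun a b. distr_deriv (regular a b f) \<phi> = regular a b g \<phi>)"

text \<open>Elements of the Sobolev spaces are given by their continuous representative on [a,b],
  so that point values make sense; weak derivatives are determined almost everywhere.\<close>

definition H1 :: "real \<Rightarrow> real \<Rightarrow> (real \<Rightarrow> real) set" where
  "H1 a b = {f \<in> L2 a b. continuous_on {a..b} f \<and> (\<exists>g\<in>L2 a b. weak_deriv a b f g)}"

definition H10 :: "real \<Rightarrow> real \<Rightarrow> (real \<Rightarrow> real) set" where
  "H10 a b = {f \<in> H1 a b. f a = 0 \<and> f b = 0}"

definition wderiv :: "real \<Rightarrow> real \<Rightarrow> (real \<Rightarrow> real) \<Rightarrow> (real \<Rightarrow> real)" where
  "wderiv a b f = (SOME g. g \<in> L2 a b \<and> weak_deriv a b f g)"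

definition H2 :: "real \<Rightarrow> real \<Rightarrow> (real \<Rightarrow> real) set" where
  "H2 a b = {f \<in> H1 a b. \<exists>h\<in>L2 a b. \<forall>\<phi>\<in>test_fun a b.
               distr_deriv (distr_deriv (regular a b f)) \<phi> = regular a b h \<phi>}"

definition H10_norm :: "real \<Rightarrow> real \<Rightarrow> (real \<Rightarrow> real) \<Rightarrow> real" where
  "H10_norm a b f = L2_norm a b (wderiv a b f)"


section \<open>Functions of time with values in a function space\<close>

text \<open>Below, a function \<open>u\<close> of time and space is regarded as the map from \<open>t\<close> to \<open>u t\<close>, and
  \<open>N\<close> is the norm of the function space in which it takes its values.\<close>

definition continuous_in :: "((real \<Rightarrow> real) \<Rightarrow> real) \<Rightarrow> real set \<Rightarrow> (real \<Rightarrow> real \<Rightarrow> real) \<Rightarrow> bool" where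
  "continuous_in N I u \<longleftrightarrow>
     (\<forall>t\<in>I. ((\<lambda>s. N (\<lambda>x. u s x - u t x)) \<longlongrightarrow> 0) (at t within I))"

definition has_time_deriv_in ::
  "((real \<Rightarrow> real) \<Rightarrow> real) \<Rightarrow> real set \<Rightarrow> (real \<Rightarrow> real \<Rightarrow> real) \<Rightarrow> (real \<Rightarrow> real \<Rightarrow> real) \<Rightarrow> bool" where
  "has_time_deriv_in N I u u' \<longleftrightarrow>
     (\<forall>t\<in>I. ((\<lambda>s. N (\<lambda>x. (u s x - u t x) / (s - t) - u' t x)) \<longlongrightarrow> 0) (at t within I))"

definition simple_in :: "(real \<Rightarrow> real) set \<Rightarrow> real \<Rightarrow> real \<Rightarrow> (real \<Rightarrow> real \<Rightarrow> real) \<Rightarrow> bool" where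
  "simple_in X a b u \<longleftrightarrow> finite (u ` {a<..<b}) \<and> u ` {a<..<b} \<subseteq> X \<and>
     (\<forall>f\<in>X. {t \<in> {a<..<b}. u t = f} \<in> sets lebesgue)"

definition bochner_measurable ::
  "(real \<Rightarrow> real) set \<Rightarrow> ((real \<Rightarrow> real) \<Rightarrow> real) \<Rightarrow> real \<Rightarrow> real \<Rightarrow> (real \<Rightarrow> real \<Rightarrow> real) \<Rightarrow> bool" where
  "bochner_measurable X N a b u \<longleftrightarrow> (AE t in lebesgue_on {a<..<b}. u t \<in> X) \<and>
     (\<exists>s. (\<forall>n::nat. simple_in X a b (s n)) \<and>
       (AE t in lebesgue_on {a<..<b}. (\<lambda>n. N (\<lambda>x. s n t x - u t x)) \<longlonglongrightarrow> 0))"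

definition bochner_L2 ::
  "(real \<Rightarrow> real) set \<Rightarrow> ((real \<Rightarrow> real) \<Rightarrow> real) \<Rightarrow> real \<Rightarrow> real \<Rightarrow> (real \<Rightarrow> real \<Rightarrow> real) set" where
  "bochner_L2 X N a b = {u. bochner_measurable X N a b u \<and> (\<lambda>t. N (u t)) \<in> L2 a b}"

text \<open>The space \<open>H\<^sup>1(a,b;H\<^sub>0\<^sup>1(0,1))\<close>, again through continuous representatives. Point
  evaluations are continuous on \<open>H\<^sub>0\<^sup>1(0,1)\<close> and separate its elements, so the identity of
  \<open>H\<^sub>0\<^sup>1(0,1)\<close>-valued integrals defining the weak derivative in time is tested at every point.\<close>

definition H1_H10 :: "real \<Rightarrow> real \<Rightarrow> (real \<Rightarrow> real \<Rightarrow> real) set" where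
  "H1_H10 a b = {u. (\<forall>t\<in>{a..b}. u t \<in> H10 0 1) \<and> continuous_in (H10_norm 0 1) {a..b} u \<and>
     u \<in> bochner_L2 (H10 0 1) (H10_norm 0 1) a b \<and>
     (\<exists>u'\<in>bochner_L2 (H10 0 1) (H10_norm 0 1) a b.
        \<forall>x\<in>{0..1}. weak_deriv a b (\<lambda>t. u t x) (\<lambda>t. u' t x))}"


section \<open>The coupled wave equations with delayed pointwise damping\<close>

definition admissible_data ::
  "real \<Rightarrow> real \<Rightarrow> real \<Rightarrow> real \<Rightarrow> (real \<Rightarrow> real) \<Rightarrow> (real \<Rightarrow> real) \<Rightarrow> (real \<Rightarrow> real) \<Rightarrow> (real \<Rightarrow> real) \<Rightarrow>
   (real \<Rightarrow> real \<Rightarrow> real) \<Rightarrow> bool" where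
  "admissible_data \<tau> \<xi> \<alpha>1 \<alpha>2 w10 w11 w20 w21 f0 \<longleftrightarrow>
     w10 \<in> H10 0 1 \<and> w20 \<in> H2 0 1 \<inter> H10 0 1 \<and> w11 \<in> H10 0 1 \<and> w21 \<in> H10 0 1 \<and>
     f0 \<in> H1_H10 (- \<tau>) 0 \<and> f0 0 \<xi> = w11 \<xi> \<and>
     (\<exists>g\<in>L2 0 1. \<forall>\<phi>\<in>test_fun 0 1.
        - distr_deriv (distr_deriv (regular 0 1 w10)) \<phi>
        + (\<alpha>1 * w11 \<xi> + \<alpha>2 * f0 (- \<tau>) \<xi>) * dirac \<xi> \<phi> = regular 0 1 g \<phi>)"

text \<open>\<open>v1\<close>, \<open>v2\<close> are the velocities, i.e. the time derivatives of \<open>w1\<close>, \<open>w2\<close>; on the history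
  interval \<open>[-\<tau>,0)\<close> only \<open>v1\<close> is given. For data satisfying \<^const>\<open>admissible_data\<close> these are
  the classical solutions of the evolution equation, of class
  \<open>C\<^sup>1([0,\<infinity>);H\<^sub>0\<^sup>1(0,1)) \<inter> C\<^sup>2([0,\<infinity>);L\<^sup>2(0,1))\<close>; membership of \<open>w1 t\<close>, \<open>w2 t\<close> in
  \<open>H\<^sub>0\<^sup>1(0,1)\<close> contains the boundary conditions.\<close>

definition is_solution ::
  "real \<Rightarrow> real \<Rightarrow> real \<Rightarrow> real \<Rightarrow> real \<Rightarrow>
   (real \<Rightarrow> real) \<Rightarrow> (real \<Rightarrow> real) \<Rightarrow> (real \<Rightarrow> real) \<Rightarrow> (real \<Rightarrow> real) \<Rightarrow> (real \<Rightarrow> real \<Rightarrow> real) \<Rightarrow>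
   (real \<Rightarrow> real \<Rightarrow> real) \<Rightarrow> (real \<Rightarrow> real \<Rightarrow> real) \<Rightarrow> (real \<Rightarrow> real \<Rightarrow> real) \<Rightarrow> (real \<Rightarrow> real \<Rightarrow> real) \<Rightarrow> bool"
where
  "is_solution \<tau> \<xi> \<alpha>1 \<alpha>2 \<beta> w10 w11 w20 w21 f0 w1 v1 w2 v2 \<longleftrightarrow>
     (\<forall>t\<ge>0. w1 t \<in> H10 0 1 \<and> w2 t \<in> H10 0 1 \<and> v1 t \<in> H10 0 1 \<and> v2 t \<in> H10 0 1) \<and>
     has_time_deriv_in (H10_norm 0 1) {0..} w1 v1 \<and> continuous_in (H10_norm 0 1) {0..} v1 \<and>
     has_time_deriv_in (H10_norm 0 1) {0..} w2 v2 \<and> continuous_in (H10_norm 0 1) {0..} v2 \<and>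
     (\<forall>x\<in>{0<..<1}. w1 0 x = w10 x \<and> v1 0 x = w11 x \<and> w2 0 x = w20 x \<and> v2 0 x = w21 x) \<and>
     (\<forall>s\<in>{-\<tau>..<0}. \<forall>x\<in>{0<..<1}. v1 s x = f0 s x) \<and>
     (\<exists>a1 a2. (\<forall>t\<ge>0. a1 t \<in> L2 0 1 \<and> a2 t \<in> L2 0 1) \<and>
        has_time_deriv_in (L2_norm 0 1) {0..} v1 a1 \<and> continuous_in (L2_norm 0 1) {0..} a1 \<and>
        has_time_deriv_in (L2_norm 0 1) {0..} v2 a2 \<and> continuous_in (L2_norm 0 1) {0..} a2 \<and>
        (\<forall>t>0. \<forall>\<phi>\<in>test_fun 0 1.
           regular 0 1 (a1 t) \<phi> - distr_deriv (distr_deriv (regular 0 1 (w1 t))) \<phi>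
           + \<alpha>1 * v1 t \<xi> * dirac \<xi> \<phi> + \<alpha>2 * v1 (t - \<tau>) \<xi> * dirac \<xi> \<phi>
           + \<beta> * distr_deriv (regular 0 1 (v2 t)) \<phi> = 0 \<and>
           regular 0 1 (a2 t) \<phi> - distr_deriv (distr_deriv (regular 0 1 (w2 t))) \<phi>
           + \<beta> * distr_deriv (regular 0 1 (v1 t)) \<phi> = 0))"

definition energy ::
  "real \<Rightarrow> real \<Rightarrow> real \<Rightarrow> (real \<Rightarrow> real \<Rightarrow> real) \<Rightarrow> (real \<Rightarrow> real \<Rightarrow> real) \<Rightarrow> (real \<Rightarrow> real \<Rightarrow> real) \<Rightarrow>
   (real \<Rightarrow> real \<Rightarrow> real) \<Rightarrow> real \<Rightarrow> real" where
  "energy \<tau> \<xi> \<kappa> w1 v1 w2 v2 t =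
     1/2 * ((LINT x|lebesgue_on {0<..<1}. (wderiv 0 1 (w1 t) x)\<^sup>2 + (v1 t x)\<^sup>2)
          + (LINT x|lebesgue_on {0<..<1}. (wderiv 0 1 (w2 t) x)\<^sup>2 + (v2 t x)\<^sup>2))
     + \<kappa>/2 * (LINT \<theta>|lebesgue_on {-\<tau><..<0}. (v1 (t + \<theta>) \<xi>)\<^sup>2)"

definition exponentially_stable ::
  "real \<Rightarrow> real \<Rightarrow> real \<Rightarrow> real \<Rightarrow> real \<Rightarrow> real \<Rightarrow> bool" where
  "exponentially_stable \<tau> \<xi> \<alpha>1 \<alpha>2 \<beta> \<kappa> \<longleftrightarrow>
     (\<exists>M>0. \<exists>\<omega>>0. \<forall>w10 w11 w20 w21 f0 w1 v1 w2 v2.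
        admissible_data \<tau> \<xi> \<alpha>1 \<alpha>2 w10 w11 w20 w21 f0 \<longrightarrow>
        is_solution \<tau> \<xi> \<alpha>1 \<alpha>2 \<beta> w10 w11 w20 w21 f0 w1 v1 w2 v2 \<longrightarrow>
        (\<forall>t\<ge>0. energy \<tau> \<xi> \<kappa> w1 v1 w2 v2 t
                 \<le> M * exp (- \<omega> * t) * energy \<tau> \<xi> \<kappa> w1 v1 w2 v2 0))"

end

theory Submission
  imports Defs
begin

text \<open>
  The system has a periodic solution of positive energy whose first component vanishes at the
  damping point for all times, so that neither the damping nor the delay term ever acts on it.

  Without feedback, \<open>w\<^sub>1 + w\<^sub>2\<close> and \<open>w\<^sub>1 - w\<^sub>2\<close> satisfy two decoupled equations
  \<open>p\<^sub>t\<^sub>t \<plusminus> \<beta> p\<^sub>t\<^sub>x - p\<^sub>x\<^sub>x = 0\<close> with Dirichlet conditions, whose eigenfrequencies coincide. The lowest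
  one is \<open>\<omega> = 2\<pi> / sqrt(\<beta>\<^sup>2 + 4)\<close>, with modes \<open>exp(i(\<omega>t \<plusminus> cx)) sin(\<pi>x)\<close>, where \<open>c = \<beta>\<omega>/2\<close>. Since the
  frequency is double, the two modes can be combined so that \<open>w\<^sub>1\<close> vanishes at any prescribed point
  \<open>\<xi>\<close>, which gives
  \<open>w\<^sub>1 = cos(\<omega>t) sin(c(x-\<xi>)) sin(\<pi>x)\<close> and \<open>w\<^sub>2 = sin(\<omega>t) cos(c(x-\<xi>)) sin(\<pi>x)\<close>.
  As the energy returns to its initial value after each period, no exponential bound can hold
  (\<open>undamped_mode_not_stable\<close>).

  The main work is to show that this smooth function is a solution in the sense of Sobolev
  spaces. A classical derivative is a weak one (\<open>weak_deriv_classical\<close>), but the \<open>H\<^sub>0\<^sup>1\<close> norm is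
  the \<open>L\<^sup>2\<close> norm of an arbitrarily chosen weak derivative, so that even its homogeneity requires
  weak derivatives to be unique almost everywhere (\<open>weak_deriv_unique\<close>). This follows from the
  fundamental lemma of the calculus of variations (\<open>fundamental_lemma\<close>), for which smooth bump
  functions are constructed from \<open>exp(-1/x)\<close>. For products of a function of time and a fixed
  profile, the vector-valued regularity conditions then reduce to scalar ones.
\<close>

section \<open>Smooth bump functions\<close>

text \<open>The function that vanishes on the left half-line and equals \<open>p(1/x) exp(-1/x)\<close> on the right
  one. Carrying the polynomial \<open>p\<close> makes the family closed under differentiation.\<close>
definition flat_exp :: "real poly \<Rightarrow> real \<Rightarrow> real" where
  "flat_exp p x = (if x > 0 then poly p (1 / x) * exp (- (1 / x)) else 0)"

lemma poly_exp_tendsto_0: "((\<lambda>y::real. poly p y * exp (- y)) \<longlongrightarrow> 0) at_top"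
proof -
  have "((\<lambda>y::real. coeff p i * (y ^ i / exp y)) \<longlongrightarrow> coeff p i * 0) at_top" for i
    by (intro tendsto_mult tendsto_const tendsto_power_div_exp_0)
  then have "((\<lambda>y. \<Sum>i\<le>degree p. coeff p i * (y ^ i / exp y)) \<longlongrightarrow> 0) at_top"
    by (intro tendsto_null_sum) simp
  then show ?thesis
    by (simp add: poly_altdef exp_minus sum_divide_distrib divide_inverse sum_distrib_right mult.assoc)
qed

lemma flat_exp_deriv:
  "(flat_exp p has_real_derivative flat_exp (monom 1 2 * (p - pderiv p)) x) (at x)"
proof -
  consider "x > 0" | "x < 0" | "x = 0" by linarith
  then show ?thesis
  proof cases
    case 1
    have "((\<lambda>x. poly p (1 / x) * exp (- (1 / x))) has_real_derivative
            flat_exp (monom 1 2 * (p - pderiv p)) x) (at x)"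
      using 1 by (auto intro!: derivative_eq_intros poly_DERIV[THEN DERIV_chain2]
          simp: flat_exp_def poly_monom power2_eq_square algebra_simps)
    moreover have "\<forall>\<^sub>F y in nhds x. flat_exp p y = poly p (1 / y) * exp (- (1 / y))"
      using eventually_nhds_in_open[of "{0<..}" x] 1
      by (auto elim!: eventually_mono simp: flat_exp_def)
    ultimately show ?thesis
      by (subst DERIV_cong_ev[OF refl _ refl]) auto
  next
    case 2
    have "\<forall>\<^sub>F y in nhds x. flat_exp p y = 0"
      using eventually_nhds_in_open[of "{..<0}" x] 2
      by (auto elim!: eventually_mono simp: flat_exp_def)
    then show ?thesis
      using 2 by (subst DERIV_cong_ev[OF refl _ refl, of _ "\<lambda>_. 0"]) (auto simp: flat_exp_def)
  next
    case 3
    \<comment> \<open>The difference quotient at 0 is \<open>p(1/y) exp(-1/y) / y\<close>, again of the form treated above.\<close>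
    have "((\<lambda>y. poly (pCons 0 p) (inverse y) * exp (- inverse y)) \<longlongrightarrow> 0) (at_right 0)"
      by (rule filterlim_compose[OF poly_exp_tendsto_0 filterlim_inverse_at_top_right])
    moreover have "\<forall>\<^sub>F y in at_right 0. poly (pCons 0 p) (inverse y) * exp (- inverse y)
        = flat_exp p y / y"
      by (auto simp: eventually_at_filter flat_exp_def field_simps intro!: always_eventually)
    ultimately have "((\<lambda>y. flat_exp p y / y) \<longlongrightarrow> 0) (at_right 0)"
      by (rule Lim_transform_eventually)
    moreover have "((\<lambda>y. flat_exp p y / y) \<longlongrightarrow> 0) (at_left 0)"
      by (rule tendsto_eventually) (auto simp: eventually_at_filter flat_exp_def intro!: always_eventually)
    ultimately have "((\<lambda>y. flat_exp p y / y) \<longlongrightarrow> 0) (at 0)"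
      by (simp add: filterlim_split_at)
    then show ?thesis
      using 3 by (simp add: has_field_derivative_iff flat_exp_def)
  qed
qed

text \<open>The linear span of the products of two flat exponentials with fixed affine arguments. By the
  product rule it is closed under differentiation, so all its elements are smooth.\<close>
inductive_set flat_products :: "real \<Rightarrow> real \<Rightarrow> real \<Rightarrow> real \<Rightarrow> (real \<Rightarrow> real) set"
  for k m k' m' where
  prod: "(\<lambda>x. flat_exp p (k * x + m) * flat_exp q (k' * x + m')) \<in> flat_products k m k' m'"
| lin: "\<lbrakk>f \<in> flat_products k m k' m'; g \<in> flat_products k m k' m'\<rbrakk>
    \<Longrightarrow> (\<lambda>x. r * f x + s * g x) \<in> flat_products k m k' m'"

lemma flat_products_deriv:
  assumes "f \<in> flat_products k m k' m'"
  shows "\<exists>g\<in>flat_products k m k' m'. \<forall>x. (f has_real_derivative g x) (at x)"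
  using assms
proof induction
  case (prod p q)
  let ?D = "\<lambda>p. monom 1 2 * (p - pderiv p)"
  have *: "(\<lambda>x. k * (flat_exp (?D p) (k * x + m) * flat_exp q (k' * x + m')) +
        k' * (flat_exp p (k * x + m) * flat_exp (?D q) (k' * x + m'))) \<in> flat_products k m k' m'"
    by (intro flat_products.intros)
  have chain: "((\<lambda>x. flat_exp p (k * x + m)) has_real_derivative flat_exp (?D p) (k * x + m) * k) (at x)"
    for p k m x
    by (rule DERIV_chain2[OF flat_exp_deriv]) (auto intro!: derivative_eq_intros)
  show ?case
    by (rule bexI[OF _ *]) (auto intro!: derivative_eq_intros chain)
next
  case (lin f g r s)
  then obtain f' g' where
    "f' \<in> flat_products k m k' m'" "\<And>x. (f has_real_derivative f' x) (at x)"
    "g' \<in> flat_products k m k' m'" "\<And>x. (g has_real_derivative g' x) (at x)"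
    by blast
  then show ?case
    by (intro bexI[of _ "\<lambda>x. r * f' x + s * g' x"])
      (auto intro!: derivative_eq_intros flat_products.intros)
qed

lemma flat_products_smooth:
  assumes "f \<in> flat_products k m k' m'"
  shows "(deriv ^^ n) f field_differentiable at x"
proof -
  have "(deriv ^^ n) f \<in> flat_products k m k' m'"
  proof (induction n)
    case (Suc n)
    then obtain g where "g \<in> flat_products k m k' m'"
      "\<And>x. ((deriv ^^ n) f has_real_derivative g x) (at x)"
      using flat_products_deriv by blast
    moreover from this have "deriv ((deriv ^^ n) f) = g"
      using DERIV_imp_deriv by blast
    ultimately show ?case by simp
  qed (use assms in simp)
  then show ?thesis
    using flat_products_deriv field_differentiable_def by blast
qed

text \<open>With \<open>F(y) = exp(-1/y)\<close> for positive \<open>y\<close> and \<open>F(y) = 0\<close> otherwise, this is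
  \<open>F(n(x-c)-1) F(n(d-x)-1)\<close>. The shift by 1 keeps the support, which is contained in
  \<open>[c+1/n, d-1/n]\<close>, away from \<open>c\<close> and \<open>d\<close>, which may thus be end points of the domain.\<close>
definition bump :: "real \<Rightarrow> real \<Rightarrow> nat \<Rightarrow> real \<Rightarrow> real" where
  "bump c d n x = flat_exp 1 (real n * x + (- real n * c - 1)) *
                  flat_exp 1 (- real n * x + (real n * d - 1))"

lemma bump_bounds: "0 \<le> bump c d n x" "bump c d n x \<le> 1"
proof -
  have "0 \<le> flat_exp 1 y \<and> flat_exp 1 y \<le> 1" for y
    by (simp add: flat_exp_def)
  then show "0 \<le> bump c d n x" "bump c d n x \<le> 1"
    by (auto simp: bump_def intro: mult_le_one)
qed

lemma bump_test_fun:
  assumes "a \<le> c" "d \<le> b" "2 / (d - c) < real n" "c < d"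
  shows "bump c d n \<in> test_fun a b"
proof -
  have n: "real n > 0"
    using assms by (smt (verit) divide_pos_pos)
  have "2 < real n * (d - c)"
    using assms by (simp add: field_simps)
  then have "2 / n < d - c"
    using n by (simp add: field_simps)
  then have "c + 1 / n \<le> d - 1 / n"
    by (simp add: field_simps)
  moreover have "bump c d n x = 0" if "x \<notin> {c + 1 / n .. d - 1 / n}" for x
  proof -
    have "real n * x + (- real n * c - 1) \<le> 0 \<or> - real n * x + (real n * d - 1) \<le> 0"
      using that n by (auto simp: field_simps)
    then show ?thesis by (auto simp: bump_def flat_exp_def)
  qed
  moreover have "(deriv ^^ k) (bump c d n) field_differentiable at x" for k x
    unfolding bump_def[abs_def]
    by (rule flat_products_smooth[OF flat_products.prod[of 1 "real n" "- real n * c - 1" 1 "- real n" "real n * d - 1"]])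
  moreover have "a < c + 1 / n" "d - 1 / n < b"
    using n assms by (smt (verit) divide_pos_pos)+
  ultimately show ?thesis
    unfolding test_fun_def by blast
qed

lemma bump_tendsto: "(\<lambda>n. bump c d n x) \<longlonglongrightarrow> indicator {c<..<d} x"
proof -
  have lim1: "(\<lambda>n. flat_exp 1 (real n * y - 1)) \<longlonglongrightarrow> (if y > 0 then 1 else 0)" for y
  proof (cases "y > 0")
    case True
    have at_top: "filterlim (\<lambda>n. real n * y - 1) at_top sequentially"
      using filterlim_tendsto_add_at_top[OF tendsto_const[of "- 1"]
          filterlim_at_top_mult_tendsto_pos[OF tendsto_const[of y] True filterlim_real_sequentially]]
      by simp
    have "(\<lambda>n. exp (- inverse (real n * y - 1))) \<longlonglongrightarrow> exp (- 0)"
      by (intro tendsto_intros filterlim_compose[OF tendsto_inverse_0_at_top at_top] filterlim_ident)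
    moreover have "\<forall>\<^sub>F n in sequentially. exp (- inverse (real n * y - 1)) = flat_exp 1 (real n * y - 1)"
      using filterlim_at_top_dense[THEN iffD1, OF at_top, rule_format, of 0]
      by eventually_elim (simp add: flat_exp_def field_simps)
    ultimately show ?thesis
      using True by (auto dest: Lim_transform_eventually)
  next
    case False
    then have "real n * y \<le> 0" for n
      by (simp add: mult_nonneg_nonpos)
    then have "flat_exp 1 (real n * y - 1) = 0" for n
      unfolding flat_exp_def by (smt (verit))
    then show ?thesis using False by simp
  qed
  have "(\<lambda>n. flat_exp 1 (real n * (x - c) - 1) * flat_exp 1 (real n * (d - x) - 1)) \<longlonglongrightarrow>
     (if x - c > 0 then 1 else 0) * (if d - x > 0 then 1 else 0)"
    by (intro tendsto_mult lim1)
  moreover have "(if x - c > 0 then 1 else 0) * (if d - x > 0 then 1 else 0) = (indicator {c<..<d} x :: real)"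
    by (auto simp: indicator_def)
  moreover have "(\<lambda>n. flat_exp 1 (real n * (x - c) - 1) * flat_exp 1 (real n * (d - x) - 1)) = (\<lambda>n. bump c d n x)"
    by (auto simp: bump_def algebra_simps)
  ultimately show ?thesis by simp
qed

section \<open>Test functions and integrability\<close>

lemma test_fun_deriv:
  assumes "\<phi> \<in> test_fun a b"
  shows "(\<phi> has_real_derivative deriv \<phi> x) (at x)" "deriv \<phi> \<in> test_fun a b"
proof -
  have D: "(deriv ^^ k) \<phi> field_differentiable at x" for k x
    using assms unfolding test_fun_def by blast
  show "(\<phi> has_real_derivative deriv \<phi> x) (at x)"
    using D[of 0] DERIV_deriv_iff_field_differentiable by auto
  obtain c d where cd: "a < c" "c \<le> d" "d < b" "\<And>x. x \<notin> {c..d} \<Longrightarrow> \<phi> x = 0"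
    using assms unfolding test_fun_def by blast
  have "deriv \<phi> x = 0" if "x \<notin> {c..d}" for x
  proof -
    have "\<forall>\<^sub>F y in nhds x. \<phi> y = 0"
      using eventually_nhds_in_open[of "- {c..d}" x] that
      by (auto elim!: eventually_mono simp: cd(4) open_Compl)
    then have "deriv \<phi> x = deriv (\<lambda>_. 0) x"
      by (rule deriv_cong_ev) simp
    then show ?thesis by simp
  qed
  moreover have "(deriv ^^ k) (deriv \<phi>) field_differentiable at x" for k x
    using D[of "Suc k" x] by (simp add: funpow_swap1)
  ultimately show "deriv \<phi> \<in> test_fun a b"
    unfolding test_fun_def using cd by blast
qed

lemma test_fun_continuous: "\<phi> \<in> test_fun a b \<Longrightarrow> continuous_on S \<phi>"
  by (meson test_fun_deriv(1) DERIV_isCont continuous_at_imp_continuous_on)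

lemma test_fun_endpoints:
  assumes "\<phi> \<in> test_fun a b"
  shows "\<phi> a = 0" "\<phi> b = 0"
  using assms unfolding test_fun_def by auto

section \<open>The fundamental lemma of the calculus of variations\<close>

text \<open>As the total integral is zero, the sets over which the integral of \<open>f\<close> vanishes form a Dynkin
  system; it contains the open intervals, hence all Borel sets.\<close>
lemma AE_zero_of_interval_integrals:
  fixes f :: "real \<Rightarrow> real"
  assumes f: "integrable lborel f"
    and zero: "\<And>c d. c < d \<Longrightarrow> (LINT x:{c<..<d}|lborel. f x) = 0"
    and total: "(LINT x|lborel. f x) = 0"
  shows "AE x in lborel. f x = 0"
proof -
  let ?G = "range (\<lambda>(c, d). {c<..<d::real})"
  have intA: "set_integrable lborel A f" if "A \<in> sets borel" for A
    using that f unfolding set_integrable_def by (intro integrable_mult_indicator) auto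
  have sub: "?G \<subseteq> Pow UNIV" by simp
  have stable: "Int_stable ?G"
    unfolding Int_stable_def
  proof (intro ballI)
    fix A B assume "A \<in> ?G" "B \<in> ?G"
    then obtain c d c' d' where "A = {c<..<d}" "B = {c'<..<d'}"
      by auto
    then have "A \<inter> B = {max c c'<..<min d d'}" by auto
    then show "A \<inter> B \<in> ?G" by auto
  qed
  have borel_sets: "sets (borel :: real measure) = sigma_sets UNIV ?G"
    by (simp add: borel_eq_box)
  have "(LINT x:A|lborel. f x) = 0" if "A \<in> sigma_sets UNIV ?G" for A
    using stable sub that
  proof (induction rule: sigma_sets_induct_disjoint)
    case (basic A)
    then obtain c d where "A = {c<..<d}" by auto
    then show ?case
      using zero[of c d] by (cases "c < d") (auto simp: set_lebesgue_integral_def)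
  next
    case (compl A)
    have A: "A \<in> sets borel"
      using compl(1) by (simp add: borel_sets)
    have "(LINT x:UNIV|lborel. f x) = (LINT x:A|lborel. f x) + (LINT x:UNIV - A|lborel. f x)"
      using A set_integral_Un[of A "UNIV - A" lborel f] intA[of A] intA[of "UNIV - A"]
      by (simp add: sets.compl_sets)
    then show ?case
      using compl total by (simp add: set_lebesgue_integral_def)
  next
    case (union A)
    have A: "A i \<in> sets borel" for i
      using union(2) by (auto simp: borel_sets)
    have "(LINT x:(\<Union>i. A i)|lborel. f x) = (\<Sum>i. LINT x:A i|lborel. f x)"
      using union(1) A
      by (intro lebesgue_integral_countable_add intA) (auto simp: disjoint_family_on_def)
    then show ?case using union by simp
  next
    case empty
    show ?case by (simp add: set_lebesgue_integral_def)
  qed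
  then have "(LINT x:A|lborel. f x) = 0" if "A \<in> sets lborel" for A
    using that by (simp add: borel_sets)
  then show ?thesis
    using density_unique_real[OF f, of "\<lambda>_. 0"] by (simp add: set_lebesgue_integral_def)
qed

lemma bump_continuous: "continuous_on S (bump c d n)"
proof -
  have "isCont (flat_exp 1) x" for x
    using flat_exp_deriv DERIV_isCont by blast
  then have "continuous_on UNIV (flat_exp 1)"
    by (simp add: continuous_at_imp_continuous_on)
  then have "continuous_on S (\<lambda>x. flat_exp 1 (k * x + m))" for k m
    by (rule continuous_on_compose2) (auto intro!: continuous_intros)
  then show ?thesis
    unfolding bump_def[abs_def] by (intro continuous_on_mult)
qed

lemma continuous_measurable_lebesgue_on:
  fixes f :: "real \<Rightarrow> real"
  assumes "continuous_on {a..b} f"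
  shows "f \<in> borel_measurable (lebesgue_on {a<..<b})"
proof -
  have "continuous_on {a<..<b} f"
    by (rule continuous_on_subset[OF assms]) auto
  then show ?thesis
    by (intro continuous_imp_measurable_on_sets_lebesgue) auto
qed

lemma integrable_mult_continuous:
  fixes g \<phi> :: "real \<Rightarrow> real"
  assumes g: "integrable (lebesgue_on {a<..<b}) g" and \<phi>: "continuous_on {a..b} \<phi>"
  shows "integrable (lebesgue_on {a<..<b}) (\<lambda>x. g x * \<phi> x)"
proof -
  have "bounded (\<phi> ` {a..b})"
    by (intro compact_imp_bounded compact_continuous_image \<phi>) simp
  then obtain B where B: "\<And>x. x \<in> {a..b} \<Longrightarrow> \<bar>\<phi> x\<bar> \<le> B"
    unfolding bounded_iff by (auto simp del: atLeastAtMost_iff)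
  show ?thesis
  proof (rule Bochner_Integration.integrable_bound)
    show "integrable (lebesgue_on {a<..<b}) (\<lambda>x. B * g x)"
      using g by simp
    show "(\<lambda>x. g x * \<phi> x) \<in> borel_measurable (lebesgue_on {a<..<b})"
      using g continuous_measurable_lebesgue_on[OF \<phi>] by simp
    have "\<bar>g x\<bar> * \<bar>\<phi> x\<bar> \<le> \<bar>B\<bar> * \<bar>g x\<bar>" if "x \<in> {a<..<b}" for x
    proof -
      have "\<bar>\<phi> x\<bar> \<le> \<bar>B\<bar>" using B[of x] that by simp
      then show ?thesis by (metis abs_ge_zero mult.commute mult_left_mono)
    qed
    then show "AE x in lebesgue_on {a<..<b}. norm (g x * \<phi> x) \<le> norm (B * g x)"
      by (intro AE_I2) (simp add: abs_mult space_restrict_space)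
  qed
qed

lemma continuous_integrable_lebesgue_on:
  fixes f :: "real \<Rightarrow> real"
  assumes "continuous_on {a..b} f"
  shows "integrable (lebesgue_on {a<..<b}) f"
proof -
  have "integrable (lebesgue_on {a<..<b}) (\<lambda>_. 1 :: real)"
    by (intro finite_measure.integrable_const finite_measureI)
      (cases "a \<le> b"; simp add: emeasure_restrict_space space_restrict_space)
  from integrable_mult_continuous[OF this assms] show ?thesis by simp
qed

text \<open>The bumps converge boundedly to the indicator of the interval, so dominated convergence applies.\<close>
lemma interval_integral_zero:
  assumes g: "integrable (lebesgue_on {a<..<b}) g"
    and zero: "\<And>\<phi>. \<phi> \<in> test_fun a b \<Longrightarrow> regular a b g \<phi> = 0"
    and cd: "a \<le> c" "c < d" "d \<le> b"
  shows "(LINT x|lebesgue_on {a<..<b}. g x * indicator {c<..<d} x) = 0"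
proof -
  let ?M = "lebesgue_on {a<..<b}"
  have meas: "bump c d n \<in> borel_measurable ?M" for n
    by (intro continuous_measurable_lebesgue_on bump_continuous)
  have "(\<lambda>n. LINT x|?M. g x * bump c d n x) \<longlonglongrightarrow> (LINT x|?M. g x * indicator {c<..<d} x)"
  proof (rule integral_dominated_convergence)
    show "(\<lambda>x. g x * indicator {c<..<d} x) \<in> borel_measurable ?M"
      using g by (intro borel_measurable_times borel_measurable_indicator)
        (use cd in \<open>auto simp: sets_restrict_space intro!: image_eqI[of _ _ "{c<..<d}"]\<close>)
    show "(\<lambda>x. g x * bump c d n x) \<in> borel_measurable ?M" for n
      using g meas by simp
    show "integrable ?M (\<lambda>x. \<bar>g x\<bar>)"
      using g by simp
    show "AE x in ?M. (\<lambda>n. g x * bump c d n x) \<longlonglongrightarrow> g x * indicator {c<..<d} x"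
      by (intro AE_I2 tendsto_mult tendsto_const bump_tendsto)
    have "\<bar>g x * bump c d n x\<bar> \<le> \<bar>g x\<bar>" for n x
      using bump_bounds[of c d n x] by (simp add: abs_mult mult_left_le)
    then show "AE x in ?M. norm (g x * bump c d n x) \<le> \<bar>g x\<bar>" for n
      by simp
  qed
  moreover have "\<forall>\<^sub>F n in sequentially. (LINT x|?M. g x * bump c d n x) = 0"
    using filterlim_at_top_dense[THEN iffD1, OF filterlim_real_sequentially, rule_format, of "2 / (d - c)"]
    by eventually_elim (use zero[OF bump_test_fun] cd in \<open>auto simp: regular_def\<close>)
  then have "(\<lambda>n. LINT x|?M. g x * bump c d n x) \<longlonglongrightarrow> 0"
    by (rule tendsto_eventually)
  ultimately show ?thesis
    using LIMSEQ_unique by blast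
qed

lemma fundamental_lemma:
  assumes g: "integrable (lebesgue_on {a<..<b}) g"
    and zero: "\<And>\<phi>. \<phi> \<in> test_fun a b \<Longrightarrow> regular a b g \<phi> = 0"
  shows "AE x in lebesgue_on {a<..<b}. g x = 0"
proof (cases "a < b")
  case True
  define G where "G = (\<lambda>x. indicator {a<..<b} x * g x)"
  have G: "integrable lebesgue G"
    using g by (simp add: G_def integrable_restrict_space)
  have G_interval: "(LINT x|lebesgue. indicator {c<..<d} x * G x) = 0" for c d
  proof (cases "max c a < min d b")
    case True
    have "(LINT x|lebesgue. indicator {c<..<d} x * G x) =
          (LINT x|lebesgue_on {a<..<b}. g x * indicator {max c a<..<min d b} x)"
      by (subst integral_restrict_space)
        (auto simp: G_def indicator_def intro!: Bochner_Integration.integral_cong)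
    also have "\<dots> = 0"
      using True by (intro interval_integral_zero g zero) auto
    finally show ?thesis .
  next
    case False
    then have "(\<lambda>x. indicator {c<..<d} x * G x) = (\<lambda>_. 0)"
      by (auto simp: G_def indicator_def fun_eq_iff)
    then show ?thesis by simp
  qed
  \<comment> \<open>Exchange the Lebesgue measurable \<open>G\<close> for a Borel representative.\<close>
  obtain f where f: "f \<in> borel_measurable lborel" "AE x in lborel. G x = f x"
    using completion_ex_borel_measurable_real[of G lborel] G by auto
  have fG: "AE x in lebesgue. f x = G x"
    using AE_completion[OF f(2)] by (auto elim: eventually_mono)
  have G_meas: "G \<in> borel_measurable lebesgue"
    using G by simp
  have f_meas: "f \<in> borel_measurable lebesgue"
    using f(1) by (rule measurable_completion)
  have "integrable lebesgue f"
    using G integrable_cong_AE[OF f_meas G_meas fG] by simp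
  then have f_int: "integrable lborel f"
    using f(1) by (simp add: integrable_completion)
  have interval: "(LINT x:{c<..<d}|lborel. f x) = 0" for c d
  proof -
    have "(LINT x:{c<..<d}|lborel. f x) = (LINT x|lebesgue. indicator {c<..<d} x * f x)"
      using f(1) by (simp add: set_lebesgue_integral_def integral_completion)
    also have "\<dots> = (LINT x|lebesgue. indicator {c<..<d} x * G x)"
      using fG f_meas G_meas
      by (intro integral_cong_AE borel_measurable_times borel_measurable_indicator)
        (auto elim: eventually_mono)
    finally show ?thesis using G_interval by simp
  qed
  have "(LINT x|lborel. f x) = (LINT x|lebesgue. f x)"
    using f(1) by (simp add: integral_completion)
  also have "\<dots> = (LINT x|lebesgue. G x)"
    using fG f_meas G_meas by (intro integral_cong_AE) auto
  also have "\<dots> = (LINT x|lebesgue. indicator {a<..<b} x * G x)"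
    by (auto simp: G_def indicator_def intro!: Bochner_Integration.integral_cong)
  finally have "(LINT x|lborel. f x) = 0"
    using G_interval by simp
  from AE_zero_of_interval_integrals[OF f_int interval this]
  have "AE x in lebesgue. f x = 0"
    by (rule AE_completion)
  with fG have "AE x in lebesgue. G x = 0"
    by eventually_elim simp
  then show ?thesis
    by (subst AE_restrict_space_iff) (auto elim!: eventually_mono simp: G_def indicator_def)
next
  case False
  then show ?thesis by (intro AE_I2) (simp add: space_restrict_space)
qed

section \<open>Uniqueness and scaling of weak derivatives\<close>

lemma L2_integrable:
  assumes "g \<in> L2 a b"
  shows "integrable (lebesgue_on {a<..<b}) g"
proof (rule Bochner_Integration.integrable_bound)
  show "integrable (lebesgue_on {a<..<b}) (\<lambda>x. 1 + (g x)\<^sup>2)"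
    using assms continuous_integrable_lebesgue_on[of a b "\<lambda>_. 1"] by (auto simp: L2_def)
  show "g \<in> borel_measurable (lebesgue_on {a<..<b})"
    using assms by (simp add: L2_def)
  have "\<bar>y\<bar> \<le> 1 + y\<^sup>2" for y :: real
    using sum_squares_bound[of 1 "\<bar>y\<bar>"] by simp
  then show "AE x in lebesgue_on {a<..<b}. norm (g x) \<le> norm (1 + (g x)\<^sup>2)"
    by (intro AE_I2) (simp add: abs_of_nonneg)
qed

lemma weak_deriv_unique:
  assumes g: "g \<in> L2 a b" "weak_deriv a b f g" and h: "h \<in> L2 a b" "weak_deriv a b f h"
  shows "AE x in lebesgue_on {a<..<b}. g x = h x"
proof -
  have "AE x in lebesgue_on {a<..<b}. g x - h x = 0"
  proof (rule fundamental_lemma)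
    show "integrable (lebesgue_on {a<..<b}) (\<lambda>x. g x - h x)"
      using g h by (intro Bochner_Integration.integrable_diff L2_integrable)
    fix \<phi> assume \<phi>: "\<phi> \<in> test_fun a b"
    have "regular a b (\<lambda>x. g x - h x) \<phi> = regular a b g \<phi> - regular a b h \<phi>"
      unfolding regular_def left_diff_distrib
      by (intro Bochner_Integration.integral_diff integrable_mult_continuous L2_integrable g h
          test_fun_continuous[OF \<phi>])
    then show "regular a b (\<lambda>x. g x - h x) \<phi> = 0"
      using g(2) h(2) \<phi> by (simp add: weak_deriv_def)
  qed
  then show ?thesis by simp
qed

lemma L2_continuous: "continuous_on {a..b} f \<Longrightarrow> f \<in> L2 a b"
  unfolding L2_def
  by (simp add: continuous_measurable_lebesgue_on continuous_integrable_lebesgue_on continuous_on_power)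

lemma L2_norm_scale: "L2_norm a b (\<lambda>x. r * f x) = \<bar>r\<bar> * L2_norm a b f"
  by (simp add: L2_norm_def power_mult_distrib real_sqrt_mult)

lemma wderiv_props:
  assumes "g \<in> L2 a b" "weak_deriv a b f g"
  shows "wderiv a b f \<in> L2 a b" "weak_deriv a b f (wderiv a b f)"
  using someI[of "\<lambda>g. g \<in> L2 a b \<and> weak_deriv a b f g" g] assms by (simp_all add: wderiv_def)

lemma regular_scale: "regular a b (\<lambda>x. r * f x) \<phi> = r * regular a b f \<phi>"
  by (simp add: regular_def mult.assoc)

lemma weak_deriv_scale:
  assumes "weak_deriv a b f g"
  shows "weak_deriv a b (\<lambda>x. r * f x) (\<lambda>x. r * g x)"
  using assms by (auto simp: weak_deriv_def distr_deriv_def regular_scale minus_mult_right)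

lemma L2_scale: "g \<in> L2 a b \<Longrightarrow> (\<lambda>x. r * g x) \<in> L2 a b"
  by (auto simp: L2_def power_mult_distrib)

text \<open>The norm is defined through a chosen weak derivative, and the choices for \<open>f\<close> and \<open>r f\<close> are
  unrelated; homogeneity therefore rests on uniqueness of weak derivatives almost everywhere.\<close>
lemma H10_norm_scale:
  assumes g: "g \<in> L2 a b" "weak_deriv a b f g"
  shows "H10_norm a b (\<lambda>x. r * f x) = \<bar>r\<bar> * L2_norm a b g"
proof -
  note rg = L2_scale[OF g(1), of r] weak_deriv_scale[OF g(2), of r]
  note w = wderiv_props[OF rg]
  have eq: "AE x in lebesgue_on {a<..<b}. wderiv a b (\<lambda>x. r * f x) x = r * g x"
    by (rule weak_deriv_unique[OF w rg])
  have "L2_norm a b (wderiv a b (\<lambda>x. r * f x)) = L2_norm a b (\<lambda>x. r * g x)"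
    unfolding L2_norm_def
    by (intro arg_cong[of _ _ sqrt] integral_cong_AE)
      (use w rg eq in \<open>auto simp: L2_def elim!: eventually_mono\<close>)
  then show ?thesis
    by (simp add: H10_norm_def L2_norm_scale)
qed

lemma weak_deriv_classical:
  assumes D: "\<And>x. (f has_real_derivative f' x) (at x)"
    and cont: "continuous_on {a..b} f'"
  shows "weak_deriv a b f f'"
  unfolding weak_deriv_def
proof
  fix \<phi> assume \<phi>: "\<phi> \<in> test_fun a b"
  note \<phi>' = test_fun_deriv[OF \<phi>]
  have f: "continuous_on {a..b} f"
    using D by (intro continuous_at_imp_continuous_on ballI DERIV_isCont)
  have cont_fd: "continuous_on {a..b} (\<lambda>x. f x * deriv \<phi> x)"
      "continuous_on {a..b} (\<lambda>x. f' x * \<phi> x)"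
    by (intro continuous_on_mult f cont test_fun_continuous[OF \<phi>] test_fun_continuous[OF \<phi>'(2)])+
  have "regular a b f (deriv \<phi>) + regular a b f' \<phi> = 0"
  proof (cases "a < b")
    case True
    let ?h = "\<lambda>x. f x * deriv \<phi> x + f' x * \<phi> x"
    have "((\<lambda>x. f x * \<phi> x) has_real_derivative ?h x) (at x within {a..b})" for x
      by (rule has_field_derivative_at_within) (rule DERIV_mult'[OF D \<phi>'(1)])
    then have "(?h has_integral (f b * \<phi> b - f a * \<phi> a)) {a..b}"
      using True
      by (intro fundamental_theorem_of_calculus)
        (simp_all add: has_real_derivative_iff_has_vector_derivative)
    then have "integral {a..b} ?h = 0"
      using test_fun_endpoints[OF \<phi>] by (simp add: integral_unique)
    moreover have "integral {a..b} ?h = (LINT x|lebesgue_on {a<..<b}. ?h x)"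
      using lebesgue_integral_eq_integral[OF
          continuous_integrable_lebesgue_on[OF continuous_on_add[OF cont_fd]]]
        integral_open_interval_real[of a b ?h] by simp
    moreover have "(LINT x|lebesgue_on {a<..<b}. ?h x) = regular a b f (deriv \<phi>) + regular a b f' \<phi>"
      unfolding regular_def
      by (rule Bochner_Integration.integral_add[OF
            continuous_integrable_lebesgue_on[OF cont_fd(1)]
            continuous_integrable_lebesgue_on[OF cont_fd(2)]])
    ultimately show ?thesis by simp
  next
    case False
    then have "space (lebesgue_on {a<..<b}) = {}"
      by (simp add: space_restrict_space)
    then show ?thesis
      unfolding regular_def by (simp add: Bochner_Integration.integral_empty)
  qed
  then show "distr_deriv (regular a b f) \<phi> = regular a b f' \<phi>"
    by (simp add: distr_deriv_def)
qed

section \<open>Separated functions of time and space\<close>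

text \<open>A twice differentiable function \<open>f\<close> with derivatives \<open>f'\<close> and \<open>f''\<close> that vanishes at both
  ends of the unit interval. It is required to be differentiable on the whole line, which spares
  one-sided derivatives; continuity of \<open>f''\<close> matters on the unit interval only.\<close>
definition dirichlet_profile :: "(real \<Rightarrow> real) \<Rightarrow> (real \<Rightarrow> real) \<Rightarrow> (real \<Rightarrow> real) \<Rightarrow> bool" where
  "dirichlet_profile f f' f'' \<longleftrightarrow>
     (\<forall>x. (f has_real_derivative f' x) (at x)) \<and> (\<forall>x. (f' has_real_derivative f'' x) (at x)) \<and>
     continuous_on {0..1} f'' \<and> f 0 = 0 \<and> f 1 = 0"

context
  fixes f f' f'' :: "real \<Rightarrow> real"
  assumes profile: "dirichlet_profile f f' f''"
begin

lemma profile_continuous: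
  "continuous_on {0..1} f" "continuous_on {0..1} f'" "continuous_on {0..1} f''"
  using profile
  by (auto simp: dirichlet_profile_def intro!: continuous_at_imp_continuous_on DERIV_isCont)

lemma profile_weak_deriv: "weak_deriv 0 1 f f'" "weak_deriv 0 1 f' f''"
  using profile by (auto intro!: weak_deriv_classical profile_continuous simp: dirichlet_profile_def)

lemma profile_H10: "(\<lambda>x. r * f x) \<in> H10 0 1"
proof -
  have "continuous_on {0..1} (\<lambda>x. r * f x)" "continuous_on {0..1} (\<lambda>x. r * f' x)"
    by (intro continuous_on_mult continuous_on_const profile_continuous)+
  then have "(\<lambda>x. r * f x) \<in> H1 0 1"
    using weak_deriv_scale[OF profile_weak_deriv(1)] L2_continuous unfolding H1_def by blast
  then show ?thesis
    using profile by (simp add: H10_def dirichlet_profile_def)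
qed

lemma profile_H10_norm:
  "H10_norm 0 1 (\<lambda>x. r * f x) = \<bar>r\<bar> * L2_norm 0 1 f'"
  by (intro H10_norm_scale L2_continuous profile_continuous profile_weak_deriv)

lemma profile_distr_deriv:
  assumes "\<phi> \<in> test_fun 0 1"
  shows "distr_deriv (regular 0 1 (\<lambda>x. r * f x)) \<phi> = r * regular 0 1 f' \<phi>"
  using weak_deriv_scale[OF profile_weak_deriv(1)] assms
  by (simp add: weak_deriv_def regular_scale)

lemma profile_distr_deriv2:
  assumes "\<phi> \<in> test_fun 0 1"
  shows "distr_deriv (distr_deriv (regular 0 1 (\<lambda>x. r * f x))) \<phi> = r * regular 0 1 f'' \<phi>"
proof -
  have "distr_deriv (distr_deriv (regular 0 1 (\<lambda>x. r * f x))) \<phi>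
      = - (r * regular 0 1 f' (deriv \<phi>))"
    using profile_distr_deriv[OF test_fun_deriv(2)[OF assms]] by (simp add: distr_deriv_def)
  also have "\<dots> = r * regular 0 1 f'' \<phi>"
    using profile_weak_deriv(2) assms by (simp add: weak_deriv_def distr_deriv_def minus_mult_right)
  finally show ?thesis .
qed

lemma profile_H2: "(\<lambda>x. r * f x) \<in> H2 0 1"
proof -
  have "(\<lambda>x. r * f'' x) \<in> L2 0 1"
    by (intro L2_scale L2_continuous profile_continuous)
  moreover have "(\<lambda>x. r * f x) \<in> H1 0 1"
    using profile_H10 by (simp add: H10_def)
  ultimately show ?thesis
    unfolding H2_def
    by (auto simp: profile_distr_deriv2 regular_scale intro!: bexI[of _ "\<lambda>x. r * f'' x"])
qed

text \<open>The time regularity of \<open>p(t) f(x)\<close> with respect to a norm \<open>N\<close> only involves the values of \<open>N\<close>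
  on multiples of \<open>f\<close>; the next two lemmas thus serve both the \<open>L\<^sup>2\<close> and the \<open>H\<^sub>0\<^sup>1\<close> norm.\<close>
lemma separated_continuous_in:
  assumes N: "\<And>r. N (\<lambda>x. r * f x) = \<bar>r\<bar> * C" and p: "continuous_on I p"
  shows "continuous_in N I (\<lambda>t x. p t * f x)"
proof -
  have "((\<lambda>s. \<bar>p s - p t\<bar> * C) \<longlongrightarrow> \<bar>p t - p t\<bar> * C) (at t within I)" if "t \<in> I" for t
    using p that by (intro tendsto_intros) (auto simp: continuous_on_def)
  moreover have "N (\<lambda>x. p s * f x - p t * f x) = \<bar>p s - p t\<bar> * C" for s t
    by (simp add: N flip: left_diff_distrib)
  ultimately show ?thesis
    by (simp add: continuous_in_def)
qed

lemma separated_has_time_deriv_in: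
  assumes N: "\<And>r. N (\<lambda>x. r * f x) = \<bar>r\<bar> * C"
    and p: "\<And>t. (p has_real_derivative p' t) (at t)"
  shows "has_time_deriv_in N I (\<lambda>t x. p t * f x) (\<lambda>t x. p' t * f x)"
proof -
  have "((\<lambda>s. \<bar>(p s - p t) / (s - t) - p' t\<bar> * C) \<longlongrightarrow> \<bar>p' t - p' t\<bar> * C) (at t within I)" for t
    using has_field_derivative_at_within[OF p]
    by (intro tendsto_intros) (simp add: has_field_derivative_iff)
  moreover have "N (\<lambda>x. (p s * f x - p t * f x) / (s - t) - p' t * f x)
      = \<bar>(p s - p t) / (s - t) - p' t\<bar> * C" for s t
  proof -
    have "(\<lambda>x. (p s * f x - p t * f x) / (s - t) - p' t * f x)
        = (\<lambda>x. ((p s - p t) / (s - t) - p' t) * f x)"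
      by (simp add: fun_eq_iff left_diff_distrib diff_divide_distrib)
    then show ?thesis by (simp add: N)
  qed
  ultimately show ?thesis
    by (simp add: has_time_deriv_in_def)
qed

lemma separated_bochner_L2:
  assumes q: "continuous_on {a..b} q"
  shows "(\<lambda>t x. q t * f x) \<in> bochner_L2 (H10 0 1) (H10_norm 0 1) a b"
proof -
  \<comment> \<open>Rounding \<open>q\<close> down to multiples of \<open>1/(n+1)\<close> gives simple functions, as \<open>q\<close> is bounded.\<close>
  define d where "d n t = real_of_int \<lfloor>real (Suc n) * q t\<rfloor> / real (Suc n)" for n t
  have q_meas: "q \<in> borel_measurable (lebesgue_on {a<..<b})"
    by (rule continuous_measurable_lebesgue_on[OF q])
  have d_meas: "d n \<in> borel_measurable (lebesgue_on {a<..<b})" for n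
    unfolding d_def using q_meas by measurable
  have "bounded (q ` {a..b})"
    by (intro compact_imp_bounded compact_continuous_image q) simp
  then obtain B where B: "\<forall>t\<in>{a..b}. \<bar>q t\<bar> \<le> B"
    unfolding bounded_iff by auto
  have d_fin: "finite (d n ` {a<..<b})" for n
  proof (rule finite_subset)
    show "d n ` {a<..<b} \<subseteq> (\<lambda>k. real_of_int k / real (Suc n)) `
        {\<lfloor>- (real (Suc n) * B)\<rfloor>..\<lfloor>real (Suc n) * B\<rfloor>}"
    proof
      fix y assume "y \<in> d n ` {a<..<b}"
      then obtain t where t: "t \<in> {a<..<b}" "y = d n t" by auto
      then have "\<bar>q t\<bar> \<le> B" using B by simp
      then have "real (Suc n) * q t \<le> real (Suc n) * B" "real (Suc n) * (- B) \<le> real (Suc n) * q t"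
        by (intro mult_left_mono; simp)+
      then have "\<lfloor>real (Suc n) * q t\<rfloor> \<in> {\<lfloor>- (real (Suc n) * B)\<rfloor>..\<lfloor>real (Suc n) * B\<rfloor>}"
        by (auto intro!: floor_mono)
      then show "y \<in> (\<lambda>k. real_of_int k / real (Suc n)) `
          {\<lfloor>- (real (Suc n) * B)\<rfloor>..\<lfloor>real (Suc n) * B\<rfloor>}"
        using t by (auto simp: d_def)
    qed
  qed simp
  have "simple_in (H10 0 1) a b (\<lambda>t x. d n t * f x)" for n
    unfolding simple_in_def
  proof (intro conjI ballI)
    have "(\<lambda>t x. d n t * f x) ` {a<..<b} = (\<lambda>r x. r * f x) ` d n ` {a<..<b}"
      by auto
    then show "finite ((\<lambda>t x. d n t * f x) ` {a<..<b})"
      using d_fin by simp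
    show "(\<lambda>t x. d n t * f x) ` {a<..<b} \<subseteq> H10 0 1"
      using profile_H10 by auto
    fix g :: "real \<Rightarrow> real"
    let ?Y = "{r \<in> d n ` {a<..<b}. (\<lambda>x. r * f x) = g}"
    have "?Y \<in> sets borel"
      using d_fin[of n] by (intro borel_closed finite_imp_closed) auto
    then have "d n -` ?Y \<inter> space (lebesgue_on {a<..<b}) \<in> sets (lebesgue_on {a<..<b})"
      by (rule measurable_sets[OF d_meas])
    moreover have "d n -` ?Y \<inter> space (lebesgue_on {a<..<b}) = {t \<in> {a<..<b}. (\<lambda>x. d n t * f x) = g}"
      by (auto simp: space_restrict_space)
    ultimately show "{t \<in> {a<..<b}. (\<lambda>x. d n t * f x) = g} \<in> sets lebesgue"
      by (simp add: sets_restrict_space_iff)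
  qed
  moreover have "(\<lambda>n. H10_norm 0 1 (\<lambda>x. d n t * f x - q t * f x)) \<longlonglongrightarrow> 0" for t
  proof -
    have "\<bar>d n t - q t\<bar> \<le> inverse (real (Suc n))" for n
    proof -
      have "\<bar>real_of_int \<lfloor>real (Suc n) * q t\<rfloor> - real (Suc n) * q t\<bar> \<le> 1"
        by linarith
      moreover have "d n t - q t = (real_of_int \<lfloor>real (Suc n) * q t\<rfloor> - real (Suc n) * q t) / real (Suc n)"
        by (simp add: d_def diff_divide_distrib del: of_nat_Suc)
      ultimately show ?thesis
        by (simp add: divide_right_mono inverse_eq_divide del: of_nat_Suc)
    qed
    then have "(\<lambda>n. d n t - q t) \<longlonglongrightarrow> 0"
      by (intro Lim_null_comparison[OF _ LIMSEQ_inverse_real_of_nat] always_eventually) simp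
    then have "(\<lambda>n. \<bar>d n t - q t\<bar> * L2_norm 0 1 f') \<longlonglongrightarrow> \<bar>0\<bar> * L2_norm 0 1 f'"
      by (intro tendsto_intros)
    then show ?thesis
      by (simp add: profile_H10_norm flip: left_diff_distrib)
  qed
  ultimately have "bochner_measurable (H10 0 1) (H10_norm 0 1) a b (\<lambda>t x. q t * f x)"
    unfolding bochner_measurable_def
    by (intro conjI exI[of _ "\<lambda>n t x. d n t * f x"] allI AE_I2 profile_H10)
  moreover have "(\<lambda>t. H10_norm 0 1 (\<lambda>x. q t * f x)) \<in> L2 a b"
    unfolding profile_H10_norm by (intro L2_continuous continuous_intros q)
  ultimately show ?thesis
    by (simp add: bochner_L2_def)
qed

lemma separated_H1_H10:
  assumes p: "\<And>t. (p has_real_derivative p' t) (at t)" and p': "continuous_on {a..b} p'"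
  shows "(\<lambda>t x. p t * f x) \<in> H1_H10 a b"
proof -
  have p_cont: "continuous_on {a..b} p"
    using p by (intro continuous_at_imp_continuous_on ballI DERIV_isCont)
  have "weak_deriv a b (\<lambda>t. p t * f x) (\<lambda>t. p' t * f x)" for x
    using weak_deriv_scale[OF weak_deriv_classical[OF p p'], of "f x"] by (simp add: mult.commute)
  then show ?thesis
    unfolding H1_H10_def mem_Collect_eq
    by (intro conjI ballI bexI[of _ "\<lambda>t x. p' t * f x"] profile_H10 p_cont p'
        separated_continuous_in[OF profile_H10_norm] separated_bochner_L2)
qed

end

lemma regular_combination_zero:
  assumes cont: "continuous_on {0..1} f" "continuous_on {0..1} g" "continuous_on {0..1} h"
    and \<phi>: "\<phi> \<in> test_fun 0 1" and eq: "\<And>x. r * f x + g x + s * h x = 0"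
  shows "r * regular 0 1 f \<phi> + regular 0 1 g \<phi> + s * regular 0 1 h \<phi> = 0"
proof -
  have int: "integrable (lebesgue_on {0<..<1}) (\<lambda>x. k x * \<phi> x)" if "continuous_on {0..1} k" for k
    by (intro continuous_integrable_lebesgue_on continuous_on_mult that test_fun_continuous[OF \<phi>])
  have "r * regular 0 1 f \<phi> + regular 0 1 g \<phi> + s * regular 0 1 h \<phi>
      = (LINT x|lebesgue_on {0<..<1}. r * (f x * \<phi> x) + g x * \<phi> x + s * (h x * \<phi> x))"
    using int[OF cont(1)] int[OF cont(2)] int[OF cont(3)] by (simp add: regular_def)
  also have "\<dots> = (LINT x|lebesgue_on {0<..<1}. (r * f x + g x + s * h x) * \<phi> x)"
    by (simp add: algebra_simps)
  finally show ?thesis by (simp add: eq)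
qed

section \<open>An undamped mode\<close>

text \<open>If \<open>a\<close> vanishes at the damping point, then \<open>w\<^sub>1 = cos(\<omega>t) a(x)\<close>, \<open>w\<^sub>2 = sin(\<omega>t) b(x)\<close> does not
  feel the two point feedbacks, and the system reduces to the ordinary differential equations
  assumed for \<open>a\<close> and \<open>b\<close>. The history of the velocity is the same formula at negative times.\<close>
lemma undamped_mode_not_stable:
  assumes a: "dirichlet_profile a a' a''" and b: "dirichlet_profile b b' b''"
    and \<xi>: "\<xi> \<in> {0<..<1}" "a \<xi> = 0" "b \<xi> \<noteq> 0" and \<omega>: "\<omega> > 0"
    and eq_a: "\<And>x. \<omega>\<^sup>2 * a x + a'' x + (- \<beta> * \<omega>) * b' x = 0"
    and eq_b: "\<And>x. \<omega>\<^sup>2 * b x + b'' x + (\<beta> * \<omega>) * a' x = 0"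
  shows "\<not> exponentially_stable \<tau> \<xi> \<alpha>1 \<alpha>2 \<beta> \<kappa>"
proof
  define C S where "C t = cos (\<omega> * t)" and "S t = sin (\<omega> * t)" for t
  let ?w1 = "\<lambda>t x. C t * a x" and ?v1 = "\<lambda>t x. (- \<omega> * S t) * a x"
  let ?w2 = "\<lambda>t x. S t * b x" and ?v2 = "\<lambda>t x. (\<omega> * C t) * b x"
  let ?a1 = "\<lambda>t x. (- \<omega>\<^sup>2 * C t) * a x" and ?a2 = "\<lambda>t x. (- \<omega>\<^sup>2 * S t) * b x"
  have D: "(C has_real_derivative - \<omega> * S t) (at t)" "(S has_real_derivative \<omega> * C t) (at t)" for t
    unfolding C_def[abs_def] S_def[abs_def] by (auto intro!: derivative_eq_intros)
  have D2: "((\<lambda>t. - \<omega> * S t) has_real_derivative - \<omega>\<^sup>2 * C t) (at t)"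
    "((\<lambda>t. \<omega> * C t) has_real_derivative - \<omega>\<^sup>2 * S t) (at t)" for t
    using DERIV_cmult[OF D(2), of "- \<omega>" t] DERIV_cmult[OF D(1), of "\<omega>" t]
    by (simp_all add: power2_eq_square mult.assoc)
  have cont: "continuous_on I C" "continuous_on I S" for I
    unfolding C_def[abs_def] S_def[abs_def] by (intro continuous_intros)+
  note L2_hom = L2_norm_scale[of 0 1] and a_hom = profile_H10_norm[OF a] and b_hom = profile_H10_norm[OF b]

  have admissible: "admissible_data \<tau> \<xi> \<alpha>1 \<alpha>2 (?w1 0) (?v1 0) (?w2 0) (?v2 0) ?v1"
    unfolding admissible_data_def
  proof (intro conjI IntI profile_H10[OF a] profile_H10[OF b] profile_H2[OF b])
    show "?v1 \<in> H1_H10 (- \<tau>) 0"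
      by (rule separated_H1_H10[OF a D2(1)]) (intro continuous_intros cont)
    show "\<exists>g\<in>L2 0 1. \<forall>\<phi>\<in>test_fun 0 1.
        - distr_deriv (distr_deriv (regular 0 1 (?w1 0))) \<phi>
        + (\<alpha>1 * ?v1 0 \<xi> + \<alpha>2 * ?v1 (- \<tau>) \<xi>) * dirac \<xi> \<phi> = regular 0 1 g \<phi>"
    proof (intro bexI ballI)
      show "(\<lambda>x. - C 0 * a'' x) \<in> L2 0 1"
        by (intro L2_scale L2_continuous profile_continuous[OF a])
    qed (simp only: profile_distr_deriv2[OF a] regular_scale \<xi>(2), simp)
  qed simp

  have exI2: "P x y \<Longrightarrow> \<exists>x y. P x y" for P and x y :: "real \<Rightarrow> real \<Rightarrow> real"
    by blast
  have solution: "is_solution \<tau> \<xi> \<alpha>1 \<alpha>2 \<beta> (?w1 0) (?v1 0) (?w2 0) (?v2 0) ?v1 ?w1 ?v1 ?w2 ?v2"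
    unfolding is_solution_def
  proof (intro conjI allI impI ballI exI2[of _ ?a1 ?a2]
      profile_H10[OF a] profile_H10[OF b])
    show "has_time_deriv_in (H10_norm 0 1) {0..} ?w1 ?v1"
      by (rule separated_has_time_deriv_in[OF a a_hom D(1)])
    show "has_time_deriv_in (H10_norm 0 1) {0..} ?w2 ?v2"
      by (rule separated_has_time_deriv_in[OF b b_hom D(2)])
    show "has_time_deriv_in (L2_norm 0 1) {0..} ?v1 ?a1"
      by (rule separated_has_time_deriv_in[OF a L2_hom D2(1)])
    show "has_time_deriv_in (L2_norm 0 1) {0..} ?v2 ?a2"
      by (rule separated_has_time_deriv_in[OF b L2_hom D2(2)])
    show "continuous_in (H10_norm 0 1) {0..} ?v1"
      by (rule separated_continuous_in[OF a a_hom]) (intro continuous_intros cont)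
    show "continuous_in (H10_norm 0 1) {0..} ?v2"
      by (rule separated_continuous_in[OF b b_hom]) (intro continuous_intros cont)
    show "continuous_in (L2_norm 0 1) {0..} ?a1"
      by (rule separated_continuous_in[OF a L2_hom]) (intro continuous_intros cont)
    show "continuous_in (L2_norm 0 1) {0..} ?a2"
      by (rule separated_continuous_in[OF b L2_hom]) (intro continuous_intros cont)
    show "?a1 t \<in> L2 0 1" for t
      by (intro L2_scale L2_continuous profile_continuous[OF a])
    show "?a2 t \<in> L2 0 1" for t
      by (intro L2_scale L2_continuous profile_continuous[OF b])
    fix t :: real and \<phi> assume \<phi>: "\<phi> \<in> test_fun 0 1"
    have "\<omega>\<^sup>2 * regular 0 1 a \<phi> + regular 0 1 a'' \<phi> + (- \<beta> * \<omega>) * regular 0 1 b' \<phi> = 0"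
      by (intro regular_combination_zero profile_continuous[OF a] profile_continuous[OF b] \<phi> eq_a)
    then have "- C t * (\<omega>\<^sup>2 * regular 0 1 a \<phi> + regular 0 1 a'' \<phi> + (- \<beta> * \<omega>) * regular 0 1 b' \<phi>) = 0"
      by simp
    then show "regular 0 1 (?a1 t) \<phi> - distr_deriv (distr_deriv (regular 0 1 (?w1 t))) \<phi>
           + \<alpha>1 * ?v1 t \<xi> * dirac \<xi> \<phi> + \<alpha>2 * ?v1 (t - \<tau>) \<xi> * dirac \<xi> \<phi>
           + \<beta> * distr_deriv (regular 0 1 (?v2 t)) \<phi> = 0"
      unfolding profile_distr_deriv2[OF a \<phi>] profile_distr_deriv[OF b \<phi>] regular_scale \<xi>(2)
      by (simp add: algebra_simps)
    have "\<omega>\<^sup>2 * regular 0 1 b \<phi> + regular 0 1 b'' \<phi> + (\<beta> * \<omega>) * regular 0 1 a' \<phi> = 0"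
      by (intro regular_combination_zero profile_continuous[OF a] profile_continuous[OF b] \<phi> eq_b)
    then have "- S t * (\<omega>\<^sup>2 * regular 0 1 b \<phi> + regular 0 1 b'' \<phi> + (\<beta> * \<omega>) * regular 0 1 a' \<phi>) = 0"
      by simp
    then show "regular 0 1 (?a2 t) \<phi> - distr_deriv (distr_deriv (regular 0 1 (?w2 t))) \<phi>
           + \<beta> * distr_deriv (regular 0 1 (?v1 t)) \<phi> = 0"
      unfolding profile_distr_deriv2[OF b \<phi>] profile_distr_deriv[OF a \<phi>] regular_scale
      by (simp add: algebra_simps)
  qed auto

  let ?E = "energy \<tau> \<xi> \<kappa> ?w1 ?v1 ?w2 ?v2"
  \<comment> \<open>At multiples of the period the state, hence the energy, has returned to its initial value.\<close>
  define T where "T n = real n * (2 * pi / \<omega>)" for n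
  have E_periodic: "?E (T n) = ?E 0" for n
  proof -
    have "\<omega> * T n = 2 * real n * pi"
      using \<omega> by (simp add: T_def)
    then have "C (T n) = C 0" "S (T n) = S 0"
      unfolding C_def S_def by (simp_all only: cos_2npi sin_2npi, simp_all)
    then show ?thesis
      by (simp add: energy_def \<xi>(2))
  qed

  have E_pos: "?E 0 > 0"
  proof -
    let ?M = "lebesgue_on {0<..<1::real}" and ?d = "wderiv 0 1 (?w2 0)"
    have "?d \<in> L2 0 1"
      by (rule wderiv_props(1)[OF _ weak_deriv_scale[OF profile_weak_deriv(1)[OF b]]])
        (intro L2_scale L2_continuous profile_continuous[OF b])
    moreover have v2: "?v2 0 \<in> L2 0 1"
      by (intro L2_scale L2_continuous profile_continuous[OF b])
    ultimately have "(LINT x|?M. (?v2 0 x)\<^sup>2) \<le> (LINT x|?M. (?d x)\<^sup>2 + (?v2 0 x)\<^sup>2)"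
      by (intro integral_mono Bochner_Integration.integrable_add) (auto simp: L2_def)
    \<comment> \<open>The velocity \<open>\<omega> b\<close> of the second component at time 0 is not zero at \<open>\<xi>\<close>.\<close>
    moreover have "(LINT x|?M. (?v2 0 x)\<^sup>2) > 0"
    proof -
      have cont_sq: "continuous_on {0..1} (\<lambda>x. (?v2 0 x)\<^sup>2)"
        by (intro continuous_intros profile_continuous[OF b])
      have "(LINT x|?M. (?v2 0 x)\<^sup>2) = integral {0..1} (\<lambda>x. (?v2 0 x)\<^sup>2)"
        using lebesgue_integral_eq_integral[OF continuous_integrable_lebesgue_on[OF cont_sq]]
          integral_open_interval_real[of 0 1 "\<lambda>x. (?v2 0 x)\<^sup>2"] by simp
      moreover have "integral {0..1} (\<lambda>x. (?v2 0 x)\<^sup>2) \<noteq> 0"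
        using integral_eq_0_iff[OF cont_sq] \<xi> \<omega> by (force simp: C_def)
      moreover have "(LINT x|?M. (?v2 0 x)\<^sup>2) \<ge> 0"
        by simp
      ultimately show ?thesis by linarith
    qed
    moreover have "(LINT x|?M. (wderiv 0 1 (?w1 0) x)\<^sup>2 + (?v1 0 x)\<^sup>2) \<ge> 0"
      by simp
    moreover have "(LINT \<theta>|lebesgue_on {-\<tau><..<0}. (?v1 (0 + \<theta>) \<xi>)\<^sup>2) = 0"
      by (simp add: \<xi>(2))
    moreover have "x \<le> y \<Longrightarrow> 0 < x \<Longrightarrow> 0 \<le> z \<Longrightarrow> h = 0 \<Longrightarrow> 0 < 1/2 * (z + y) + \<kappa>/2 * h" for x y z h
      by simp
    ultimately show ?thesis
      unfolding energy_def by blast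
  qed

  assume "exponentially_stable \<tau> \<xi> \<alpha>1 \<alpha>2 \<beta> \<kappa>"
  then obtain M \<mu> where M: "M > 0" "\<mu> > 0"
    and stable: "\<forall>w10 w11 w20 w21 f0 w1 v1 w2 v2.
        admissible_data \<tau> \<xi> \<alpha>1 \<alpha>2 w10 w11 w20 w21 f0 \<longrightarrow>
        is_solution \<tau> \<xi> \<alpha>1 \<alpha>2 \<beta> w10 w11 w20 w21 f0 w1 v1 w2 v2 \<longrightarrow>
        (\<forall>t\<ge>0. energy \<tau> \<xi> \<kappa> w1 v1 w2 v2 t
                 \<le> M * exp (- \<mu> * t) * energy \<tau> \<xi> \<kappa> w1 v1 w2 v2 0)"
    unfolding exponentially_stable_def by blast
  note decay = stable[rule_format, OF admissible solution]
  have "1 \<le> M * exp (- \<mu> * T n)" for n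
  proof -
    have "T n \<ge> 0" using \<omega> by (simp add: T_def)
    then have "1 * ?E 0 \<le> M * exp (- \<mu> * T n) * ?E 0"
      using decay[of "T n"] E_periodic[of n] by simp
    then show ?thesis using E_pos by (rule mult_right_le_imp_le)
  qed
  moreover have "(\<lambda>n. M * exp (- \<mu> * T n)) \<longlonglongrightarrow> M * 0"
  proof (intro tendsto_mult tendsto_const filterlim_compose[OF exp_at_bot])
    have "filterlim (\<lambda>n. (\<mu> * (2 * pi / \<omega>)) * real n) at_top sequentially"
      using M \<omega> by (intro filterlim_tendsto_pos_mult_at_top[OF tendsto_const _ filterlim_real_sequentially]) simp
    then show "filterlim (\<lambda>n. - \<mu> * T n) at_bot sequentially"
      by (simp add: T_def filterlim_uminus_at_bot mult_ac)
  qed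
  ultimately show False
    using LIMSEQ_le_const[of "\<lambda>n. M * exp (- \<mu> * T n)" "M * 0" 1] by auto
qed

theorem mainTheorem3:
  fixes \<tau> \<xi> \<alpha>1 \<alpha>2 \<beta> \<kappa> :: real
  assumes "\<tau> > 0" and "0 < \<alpha>2" and "\<alpha>2 < \<alpha>1"
    and "\<xi> \<in> {0<..<1}" and "\<beta> > 0"
    and "\<tau> * \<alpha>2 \<le> \<kappa>" and "\<kappa> \<le> \<tau> * (2 * \<alpha>1 - \<alpha>2)"
  shows "\<not> exponentially_stable \<tau> \<xi> \<alpha>1 \<alpha>2 \<beta> \<kappa>"
proof -
  \<comment> \<open>These constants solve \<open>2 c = \<beta> \<omega>\<close> and \<open>\<omega>\<^sup>2 + c\<^sup>2 = \<pi>\<^sup>2\<close>, the conditions for both equations.\<close>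
  define \<omega> where "\<omega> = 2 * pi / sqrt (\<beta>\<^sup>2 + 4)"
  define c where "c = \<beta> * \<omega> / 2"
  have "sqrt (\<beta>\<^sup>2 + 4) > 0"
    by (simp add: add_nonneg_pos)
  then have \<omega>: "\<omega> > 0"
    by (simp add: \<omega>_def)
  have "(sqrt (\<beta>\<^sup>2 + 4))\<^sup>2 = \<beta>\<^sup>2 + 4" by simp
  then have "\<omega>\<^sup>2 * (\<beta>\<^sup>2 + 4) = 4 * pi\<^sup>2"
    using \<open>sqrt (\<beta>\<^sup>2 + 4) > 0\<close> by (simp add: \<omega>_def power_divide power_mult_distrib)
  then have freq: "\<omega>\<^sup>2 = pi\<^sup>2 - c\<^sup>2"
    by (simp add: c_def power_divide power_mult_distrib field_simps)
  have \<beta>\<omega>: "\<beta> * \<omega> = 2 * c"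
    by (simp add: c_def)
  define s k p q where "s x = sin (c * (x - \<xi>))" and "k x = cos (c * (x - \<xi>))"
    and "p x = sin (pi * x)" and "q x = cos (pi * x)" for x
  have D: "(s has_real_derivative c * k x) (at x)" "(k has_real_derivative - c * s x) (at x)"
    "(p has_real_derivative pi * q x) (at x)" "(q has_real_derivative - pi * p x) (at x)" for x
    unfolding s_def[abs_def] k_def[abs_def] p_def[abs_def] q_def[abs_def]
    by (auto intro!: derivative_eq_intros)
  define a a' a'' where "a x = s x * p x"
    and "a' x = c * k x * p x + pi * s x * q x"
    and "a'' x = - (c\<^sup>2 + pi\<^sup>2) * s x * p x + 2 * c * pi * k x * q x" for x
  define b b' b'' where "b x = k x * p x"
    and "b' x = - c * s x * p x + pi * k x * q x"
    and "b'' x = - (c\<^sup>2 + pi\<^sup>2) * k x * p x - 2 * c * pi * s x * q x" for x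
  have cont: "continuous_on {0..1} s" "continuous_on {0..1} k" "continuous_on {0..1} p"
    "continuous_on {0..1} q"
    using D by (auto intro!: continuous_at_imp_continuous_on DERIV_isCont)
  have ends: "p 0 = 0" "p 1 = 0"
    by (simp_all add: p_def)
  have "dirichlet_profile a a' a''"
    unfolding dirichlet_profile_def a_def[abs_def] a'_def[abs_def] a''_def[abs_def]
    by (auto intro!: derivative_eq_intros D continuous_intros cont
        simp: ends power2_eq_square algebra_simps)
  moreover have "dirichlet_profile b b' b''"
    unfolding dirichlet_profile_def b_def[abs_def] b'_def[abs_def] b''_def[abs_def]
    by (auto intro!: derivative_eq_intros D continuous_intros cont
        simp: ends power2_eq_square algebra_simps)
  moreover have "a \<xi> = 0" "b \<xi> \<noteq> 0"
  proof -
    have "sin (pi * \<xi>) > 0"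
      using assms by (intro sin_gt_zero) auto
    then show "a \<xi> = 0" "b \<xi> \<noteq> 0"
      by (simp_all add: a_def b_def s_def k_def p_def)
  qed
  moreover have "\<omega>\<^sup>2 * a x + a'' x + (- \<beta> * \<omega>) * b' x = 0"
    "\<omega>\<^sup>2 * b x + b'' x + (\<beta> * \<omega>) * a' x = 0" for x
    unfolding freq mult_minus_left \<beta>\<omega> a_def a'_def a''_def b_def b'_def b''_def
    by (simp_all add: power2_eq_square algebra_simps)
  ultimately show ?thesis
    using undamped_mode_not_stable[of a a' a'' b b' b'' \<xi> \<omega> \<beta>] assms(4) \<omega> by blast
qed

end
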